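(* Let $\alpha>0$, $s>0$, let $n\ge1$ be an integer, and let $H_n(s):=s\frac{d}{ds}\ln D_n(s)$. Then the recurrence coefficients of the monic orthogonal polynomials for the weight $x^\alpha e^{-x-s/x}$ on $(0,\infty)$ are $$\alpha_n=2n+1+\alpha+\frac{2s(H_n')^2-2sH_n'}{sH_n''+n-(2n+\alpha)H_n'},$$ $$\beta_n=n(n+\alpha)+sH_n'-H_n .$$
   Context: For $\alpha>0$ and $s>0$ let $w(x,s)=x^{\alpha}e^{-x-s/x}$ on $(0,\infty)$ and let $P_n(x)=P_n(x,s)$, $n\ge0$, be the monic polynomials of degree $n$ with $\int_0^\infty P_jP_k\,w(x,s)\,dx=h_j(s)\delta_{jk}$. The recurrence coefficients $\alpha_n(s)$ and $\beta_n(s)=h_n/h_{n-1}$ ($n\ge1$) are defined by $zP_n(z)=P_{n+1}(z)+\alpha_nP_n(z)+\beta_nP_{n-1}(z)$ (the subscripted $\alpha_n$ is not to be confused with the parameter $\alpha$). The Hankel determinant is $$D_n(s)=\det\left(\int_0^\infty x^{j+k}w(x,s)\,dx\right)_{j,k=0}^{n-1}.$$ Primes denote $d/ds$. *)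

theory Defs
  imports
    "HOL-Analysis.Analysis"
    "HOL-Computational_Algebra.Polynomial"
    "Jordan_Normal_Form.Determinant"
begin

definition weight :: "real \<Rightarrow> real \<Rightarrow> real \<Rightarrow> real" where
  "weight \<alpha> s x = x powr \<alpha> * exp (- x - s / x)"

definition monic_orthogonal :: "real \<Rightarrow> real \<Rightarrow> (nat \<Rightarrow> real poly) \<Rightarrow> (nat \<Rightarrow> real) \<Rightarrow> bool" where
  "monic_orthogonal \<alpha> s P h \<longleftrightarrow>
     (\<forall>k. degree (P k) = k \<and> lead_coeff (P k) = 1) \<and>
     (\<forall>j k. (LINT x:{0<..}|lborel. poly (P j) x * poly (P k) x * weight \<alpha> s x)
              = (if j = k then h j else 0))"

text \<open>In the following definition \<open>a\<close> and \<open>b\<close> are the sequences written $(\alpha_n)$ and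
  $(\beta_n)$ in the literature, and \<open>[:0, 1:]\<close> is the polynomial $z$.  The first conjunct is the
  usual recurrence at $n = 0$, where the $P_{-1}$ term is absent; \<open>b 0\<close> is not constrained.\<close>

definition recurrence_coefficients ::
    "(nat \<Rightarrow> real poly) \<Rightarrow> (nat \<Rightarrow> real) \<Rightarrow> (nat \<Rightarrow> real) \<Rightarrow> (nat \<Rightarrow> real) \<Rightarrow> bool" where
  "recurrence_coefficients P h a b \<longleftrightarrow>
     [:0, 1:] * P 0 = P 1 + Polynomial.smult (a 0) (P 0) \<and>
     (\<forall>n\<ge>1. [:0, 1:] * P n = P (n + 1) + Polynomial.smult (a n) (P n) + Polynomial.smult (b n) (P (n - 1))
             \<and> b n = h n / h (n - 1))"

definition moment :: "real \<Rightarrow> real \<Rightarrow> nat \<Rightarrow> real" where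
  "moment \<alpha> s k = (LINT x:{0<..}|lborel. x ^ k * weight \<alpha> s x)"

definition hankel_det :: "real \<Rightarrow> nat \<Rightarrow> real \<Rightarrow> real" where
  "hankel_det \<alpha> n s = Determinant.det (Matrix.mat n n (\<lambda>(j, k). moment \<alpha> s (j + k)))"

definition log_deriv_hankel :: "real \<Rightarrow> nat \<Rightarrow> real \<Rightarrow> real" where
  "log_deriv_hankel \<alpha> n s = s * deriv (\<lambda>t. ln (hankel_det \<alpha> n t)) s"

end

(*
  Write L for integration against the weight and L(f/x) for integration against w/x.  The paper's
  auxiliary quantities are A_n = s L(P_n^2/x)/h_n and b_n = s L(P_n P_{n-1}/x)/h_{n-1}.

  At fixed s, integrating (x P_n^2 w)' and (x P_n P_{n-1} w)' over the half line gives
  alpha_n = 2n+1+alpha+A_n and beta_n = n(n+alpha) + b_n + (A_0 + ... + A_{n-1}).  Since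
  L(P_n P_m/x) = P_m(0) L(P_n/x) for m <= n, the three-term recurrences of P_n(0) and L(P_n/x) and
  their Casoratian h_{n-1} yield
    beta_n A_n A_{n-1} = b_n (b_n - s),   beta_n (A_n + A_{n-1}) = n s - (2n+alpha) b_n.

  In s, h_n' = -h_n A_n/s and the subleading coefficient of P_n has derivative b_n/s.  As D_n is the
  product of the h_j, H_n = -(A_0 + ... + A_{n-1}), which is n(n+alpha) plus that subleading
  coefficient; so s H_n' = b_n and s^2 H_n'' = beta_n (A_{n-1} - A_n).  Therefore
  the denominator in the formula for alpha_n is 2 beta_n A_{n-1}/s, which is positive, and the
  numerator is 2 beta_n A_n A_{n-1}/s.
*)

theory Submission
  imports Defs "HOL-Real_Asymp.Real_Asymp"
begin

section \<open>Moments of the weight\<close>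

lemma weight_pos: "x > 0 \<Longrightarrow> weight c t x > 0"
  by (simp add: weight_def)

lemma weight_nonneg: "weight c t x \<ge> 0"
  by (simp add: weight_def)

lemma borel_measurable_weight [measurable]: "weight c t \<in> borel_measurable borel"
  unfolding weight_def by measurable

lemma weight_shift: "x > 0 \<Longrightarrow> x ^ k * weight c t x = weight (c + real k) t x"
  by (simp add: weight_def powr_add powr_realpow)

lemma weight_diff_1: "x > 0 \<Longrightarrow> weight (c - 1) t x = weight c t x / x"
  by (simp add: weight_def powr_diff)

lemma weight_le_weight_0: "t \<ge> 0 \<Longrightarrow> x > 0 \<Longrightarrow> weight c t x \<le> weight c 0 x"
  by (simp add: weight_def)

text \<open>At \<open>t = 0\<close> this is the Gamma integral; for \<open>t > 0\<close> the extra
  factor exp(-t/x) is at most 1.\<close>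

lemma set_integrable_weight:
  assumes "c > -1" "t \<ge> 0"
  shows "set_integrable lborel {0<..} (weight c t)"
proof -
  have "(\<lambda>x::real. x powr c / exp x) integrable_on {0..}"
    using Gamma_integral_real[of "c + 1"] assms by (auto simp: integrable_on_def)
  then have "set_integrable lebesgue {0..} (\<lambda>x::real. x powr c / exp x)"
    by (intro nonnegative_absolutely_integrable_1) auto
  then have "set_integrable lebesgue {0<..} (\<lambda>x::real. x powr c / exp x)"
    by (rule set_integrable_subset) auto
  then have "set_integrable lebesgue {0<..} (weight c 0)"
    unfolding weight_def by (simp add: exp_minus field_simps)
  then have "set_integrable lborel {0<..} (weight c 0)"
    unfolding set_integrable_def by (subst (asm) integrable_completion) auto
  then show ?thesis
    unfolding set_integrable_def
    by (rule Bochner_Integration.integrable_bound)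
       (use assms in \<open>auto simp: indicator_def weight_nonneg weight_le_weight_0\<close>)
qed

text \<open>With a real exponent, multiplying or dividing by x only shifts \<open>c\<close>. For
  \<open>t > 0\<close> the value is 2 t^((c+1)/2) K_{c+1}(2 sqrt t), with K the modified Bessel
  function.\<close>

definition mom :: "real \<Rightarrow> real \<Rightarrow> real" where
  "mom c t = (LINT x:{0<..}|lborel. weight c t x)"

text \<open>Bounds the difference quotients of exp(-t/x) in t by 1/x, uniformly in t, as dominated
  convergence requires.\<close>

lemma exp_minus_lipschitz:
  fixes x y :: real
  assumes "x \<ge> 0" "y \<ge> 0"
  shows "\<bar>exp (-x) - exp (-y)\<bar> \<le> \<bar>x - y\<bar>"
proof -
  have *: "exp (-u) - exp (-v) \<le> v - u" if "0 \<le> u" "u \<le> v" for u v :: real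
  proof -
    have "exp (-u) - exp (-v) = exp (-u) * (1 - exp (u - v))"
      by (simp add: algebra_simps flip: exp_add)
    also have "\<dots> \<le> 1 * (v - u)"
    proof (rule mult_mono)
      show "1 - exp (u - v) \<le> v - u" using exp_ge_add_one_self[of "u - v"] by linarith
    qed (use that in auto)
    finally show ?thesis by simp
  qed
  from *[of x y] *[of y x] assms show ?thesis by (cases "x \<le> y") auto
qed

text \<open>Differentiation under the integral sign brings down -1/x. The majorant
  \<open>weight (c - 1) 0\<close> is integrable because \<open>c > 0\<close>.\<close>

lemma has_real_derivative_mom:
  assumes "c > 0" "t > 0"
  shows "(mom c has_real_derivative - mom (c - 1) t) (at t)"
proof -
  have "(\<lambda>y. (mom c y - mom c t) / (y - t)) \<midarrow>t\<rightarrow> - mom (c - 1) t"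
    unfolding tendsto_at_iff_sequentially
  proof (intro allI impI)
    fix X :: "nat \<Rightarrow> real"
    assume X: "\<forall>i. X i \<in> UNIV - {t}" "X \<longlonglongrightarrow> t"
    from order_tendstoD(1)[OF X(2) \<open>t > 0\<close>] obtain N where N: "\<And>n. n \<ge> N \<Longrightarrow> X n > 0"
      by (auto simp: eventually_sequentially)
    \<comment> \<open>Dropping the first \<open>N\<close> terms makes every \<open>Y n\<close>
      positive, as the Lipschitz bound needs; \<open>LIMSEQ_offset\<close> restores them at the
      end.\<close>
    define Y where "Y = (\<lambda>n. X (n + N))"
    have Y: "Y n > 0" "Y n \<noteq> t" for n using X N by (auto simp: Y_def)
    have Ylim: "Y \<longlonglongrightarrow> t" unfolding Y_def using X(2) by (rule LIMSEQ_ignore_initial_segment)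
    let ?s = "\<lambda>n x. indicator {0<..} x *\<^sub>R ((weight c (Y n) x - weight c t x) / (Y n - t))"
    let ?f = "\<lambda>x. indicator {0<..} x *\<^sub>R (- weight (c - 1) t x)"
    have "(\<lambda>n. integral\<^sup>L lborel (?s n)) \<longlonglongrightarrow> integral\<^sup>L lborel ?f"
    proof (rule integral_dominated_convergence[where w = "\<lambda>x. indicator {0<..} x *\<^sub>R weight (c - 1) 0 x"])
      show "integrable lborel (\<lambda>x. indicator {0<..} x *\<^sub>R weight (c - 1) 0 x)"
        using set_integrable_weight[of "c - 1" 0] assms by (simp add: set_integrable_def)
      show "AE x in lborel. (\<lambda>n. ?s n x) \<longlonglongrightarrow> ?f x"
      proof (rule AE_I2)
        fix x :: real
        show "(\<lambda>n. ?s n x) \<longlonglongrightarrow> ?f x"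
        proof (cases "x > 0")
          case True
          have "((\<lambda>u. weight c u x) has_real_derivative - weight (c - 1) t x) (at t)"
            unfolding weight_def using True
            by (auto intro!: derivative_eq_intros simp: powr_diff field_simps)
          then have "(\<lambda>y. (weight c y x - weight c t x) / (y - t)) \<midarrow>t\<rightarrow> - weight (c - 1) t x"
            by (simp add: has_field_derivative_iff)
          then have "((\<lambda>y. (weight c y x - weight c t x) / (y - t)) \<circ> Y) \<longlonglongrightarrow> - weight (c - 1) t x"
            using Y Ylim by (auto simp: tendsto_at_iff_sequentially)
          then show ?thesis using True by (simp add: o_def)
        qed auto
      qed
      show "AE x in lborel. norm (?s n x) \<le> indicator {0<..} x *\<^sub>R weight (c - 1) 0 x" for n
      proof (rule AE_I2)
        fix x :: real
        show "norm (?s n x) \<le> indicator {0<..} x *\<^sub>R weight (c - 1) 0 x"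
        proof (cases "x > 0")
          case True
          have "\<bar>weight c (Y n) x - weight c t x\<bar>
                  = weight c 0 x * \<bar>exp (- (Y n / x)) - exp (- (t / x))\<bar>"
          proof -
            have factor: "weight c u x = weight c 0 x * exp (- (u / x))" for u
              by (simp add: weight_def flip: exp_add)
            have "weight c (Y n) x - weight c t x
                         = weight c 0 x * (exp (- (Y n / x)) - exp (- (t / x)))"
              by (simp add: factor[of "Y n"] factor[of t] right_diff_distrib)
            then show ?thesis by (simp add: abs_mult weight_nonneg)
          qed
          also have "\<dots> \<le> weight c 0 x * \<bar>Y n / x - t / x\<bar>"
            using True Y[of n] assms
            by (intro mult_left_mono exp_minus_lipschitz weight_nonneg) auto
          also have "\<dots> = weight (c - 1) 0 x * \<bar>Y n - t\<bar>"
            using True by (simp add: weight_diff_1 abs_divide flip: diff_divide_distrib)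
          finally show ?thesis using True Y[of n] by (simp add: divide_simps)
        qed auto
      qed
    qed measurable
    moreover have "integral\<^sup>L lborel (?s n) = (mom c (Y n) - mom c t) / (Y n - t)" for n
    proof -
      have "(LINT x:{0<..}|lborel. (weight c (Y n) x - weight c t x))
              = mom c (Y n) - mom c t"
        unfolding mom_def using assms Y[of n]
        by (intro set_integral_diff set_integrable_weight) auto
      moreover have "integral\<^sup>L lborel (?s n)
          = (LINT x:{0<..}|lborel. (weight c (Y n) x - weight c t x) / (Y n - t))"
        by (simp add: set_lebesgue_integral_def)
      ultimately show ?thesis
        by (simp only: set_integral_divide_zero)
    qed
    moreover have "integral\<^sup>L lborel ?f = - mom (c - 1) t"
      by (simp add: mom_def set_lebesgue_integral_def)
    ultimately have "(\<lambda>n. (mom c (Y n) - mom c t) / (Y n - t)) \<longlonglongrightarrow> - mom (c - 1) t"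
      by (simp only:)
    then have "(\<lambda>n. (mom c (X (n + N)) - mom c t) / (X (n + N) - t)) \<longlonglongrightarrow> - mom (c - 1) t"
      by (simp only: Y_def)
    then show "((\<lambda>y. (mom c y - mom c t) / (y - t)) \<circ> X) \<longlonglongrightarrow> - mom (c - 1) t"
      unfolding o_def by (rule LIMSEQ_offset)
  qed
  then show ?thesis by (simp add: has_field_derivative_iff)
qed

text \<open>Integrate the derivative of x^(c+1) exp(-x-t/x) over the half line; both boundary terms
  vanish.\<close>

lemma mom_rec:
  assumes "c > 0" "t > 0"
  shows "mom (c + 1) t = (c + 1) * mom c t + t * mom (c - 1) t"
proof -
  let ?f = "\<lambda>x. (c + 1) * weight c t x + t * weight (c - 1) t x - weight (c + 1) t x"
  let ?F = "weight (c + 1) t"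
  have int: "set_integrable lborel {0<..} (\<lambda>x. (c + 1) * weight c t x)"
    "set_integrable lborel {0<..} (\<lambda>x. t * weight (c - 1) t x)"
    "set_integrable lborel {0<..} (\<lambda>x. weight (c + 1) t x)"
    using assms set_integrable_weight[of c t] set_integrable_weight[of "c - 1" t]
      set_integrable_weight[of "c + 1" t] by auto
  have ivl: "einterval 0 \<infinity> = {0::real<..}"
    by (auto simp: einterval_def)
  have "(LBINT x=0..\<infinity>. ?f x) = 0 - 0"
  proof (rule interval_integral_FTC_integrable)
    show "(?F has_vector_derivative ?f x) (at x)" if "0 < ereal x" for x
    proof -
      have x: "x > 0" using that by simp
      have "((\<lambda>x. exp (- x - t / x)) has_real_derivative exp (- x - t / x) * (- 1 + t / x\<^sup>2)) (at x)"
        using x by (auto intro!: derivative_eq_intros simp: power2_eq_square)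
      from DERIV_mult[OF has_real_derivative_powr[OF x, of "c + 1"] this]
      have "(?F has_real_derivative ?f x) (at x)"
        unfolding weight_def
        by (rule DERIV_cong) (use x in \<open>simp add: powr_diff powr_add field_simps power2_eq_square\<close>)
      then show ?thesis by (simp add: has_real_derivative_iff_has_vector_derivative)
    qed
    show "isCont ?f x" if "0 < ereal x" for x
      unfolding weight_def using that by (intro continuous_intros) auto
    show "set_integrable lborel (einterval 0 \<infinity>) ?f"
      unfolding ivl using int by (intro set_integral_diff set_integral_add) auto
    \<comment> \<open>At either end \<open>?F\<close> is squeezed between 0 and its counterpart for
      \<open>t = 0\<close>.\<close>
    have "((\<lambda>x. weight (c + 1) 0 x) \<longlongrightarrow> 0) (at_right 0)"
      unfolding weight_def using assms by real_asymp
    then have "(?F \<longlongrightarrow> 0) (at_right 0)"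
      by (rule tendsto_sandwich[OF _ _ tendsto_const, rotated 2])
         (use assms in \<open>auto simp: weight_nonneg eventually_at_filter weight_le_weight_0\<close>)
    then show "((?F \<circ> real_of_ereal) \<longlongrightarrow> 0) (at_right 0)"
      by (simp add: zero_ereal_def ereal_tendsto_simps)
    have "((\<lambda>x. weight (c + 1) 0 x) \<longlongrightarrow> 0) at_top"
      unfolding weight_def using assms by real_asymp
    moreover have ev: "eventually (\<lambda>x. ?F x \<le> weight (c + 1) 0 x) at_top"
      using eventually_gt_at_top[of "0::real"]
      by eventually_elim (use assms in \<open>simp add: weight_le_weight_0\<close>)
    ultimately have "(?F \<longlongrightarrow> 0) at_top"
      using tendsto_sandwich[OF _ ev tendsto_const] by (auto simp: weight_nonneg)
    then show "((?F \<circ> real_of_ereal) \<longlongrightarrow> 0) (at_left \<infinity>)"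
      by (simp add: ereal_tendsto_simps)
  qed auto
  then have "(LINT x:{0<..}|lborel. ?f x) = 0"
    by (simp add: interval_lebesgue_integral_def ivl)
  then have "(c + 1) * mom c t + t * mom (c - 1) t - mom (c + 1) t = 0"
    unfolding mom_def using int by (simp add: set_integral_diff set_integral_add)
  then show ?thesis by simp
qed

section \<open>The integration functionals on polynomials\<close>

definition Lf :: "real \<Rightarrow> real \<Rightarrow> real poly \<Rightarrow> real" where
  "Lf c t p = (LINT x:{0<..}|lborel. poly p x * weight c t x)"

lemma set_integrable_poly_weight:
  assumes "c > -1" "t \<ge> 0"
  shows "set_integrable lborel {0<..} (\<lambda>x. poly p x * weight c t x)"
proof -
  have "set_integrable lborel {0<..} (\<lambda>x. coeff p i * weight (c + i) t x)" for i
    using assms by (intro set_integrable_mult_right set_integrable_weight) auto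
  then have "set_integrable lborel {0<..} (\<lambda>x. \<Sum>i\<le>degree p. coeff p i * weight (c + i) t x)"
    unfolding set_integrable_def scaleR_sum_right by (intro Bochner_Integration.integrable_sum) auto
  also have "?this \<longleftrightarrow> ?thesis"
    by (intro set_integrable_cong)
       (auto simp: poly_altdef sum_distrib_right mult.assoc weight_shift)
  finally show ?thesis .
qed

text \<open>The bound \<open>N\<close> is free so that polynomials of different degrees, or a family
  varying with the parameter, share one index range.\<close>

lemma Lf_eq_sum:
  assumes "c > -1" "t \<ge> 0" "degree p \<le> N"
  shows "Lf c t p = (\<Sum>i\<le>N. coeff p i * mom (c + i) t)"
proof -
  have "Lf c t p = (LINT x:{0<..}|lborel. (\<Sum>i\<le>N. coeff p i * weight (c + i) t x))"
    unfolding Lf_def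
  proof (rule set_lebesgue_integral_cong, simp, intro allI impI)
    fix x :: real assume "x \<in> {0<..}"
    have "poly p x = (\<Sum>i\<le>N. coeff p i * x ^ i)"
      unfolding poly_altdef using assms(3)
      by (intro sum.mono_neutral_left) (auto simp: coeff_eq_0)
    then show "poly p x * weight c t x = (\<Sum>i\<le>N. coeff p i * weight (c + i) t x)"
      using \<open>x \<in> _\<close> by (auto simp: sum_distrib_right mult.assoc weight_shift)
  qed
  also have "\<dots> = (\<Sum>i\<le>N. coeff p i * mom (c + i) t)"
  proof -
    have "set_integrable lborel {0<..} (\<lambda>x. coeff p i * weight (c + i) t x)" for i
      using assms by (intro set_integrable_mult_right set_integrable_weight) auto
    then show ?thesis
      unfolding mom_def set_integral_mult_right[symmetric]
      unfolding set_lebesgue_integral_def set_integrable_def scaleR_sum_right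
      by (intro Bochner_Integration.integral_sum) auto
  qed
  finally show ?thesis .
qed

text \<open>A zero integral would make p^2 w vanish almost everywhere; as p has finitely many roots
  and w is positive, the interval (0,1) would be null.\<close>

lemma Lf_pos:
  assumes "c > -1" "t \<ge> 0" "p \<noteq> 0"
  shows "Lf c t (p * p) > 0"
proof -
  let ?f = "\<lambda>x. indicator {0<..} x *\<^sub>R (poly (p * p) x * weight c t x)"
  have int: "integrable lborel ?f"
    using set_integrable_poly_weight[of c t "p * p"] assms by (simp add: set_integrable_def)
  have nn: "AE x in lborel. 0 \<le> ?f x"
    by (auto simp: weight_nonneg indicator_def)
  have "integral\<^sup>L lborel ?f \<noteq> 0"
  proof
    assume "integral\<^sup>L lborel ?f = 0"
    then have "AE x in lborel. ?f x = 0"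
      using integral_nonneg_eq_0_iff_AE[OF int nn] by simp
    moreover have "AE x in lborel. x \<notin> {x. poly p x = 0}"
      using poly_roots_finite[OF \<open>p \<noteq> 0\<close>] finite_imp_null_set_lborel by (intro AE_not_in) auto
    ultimately have "AE x in lborel. x \<notin> {0<..<1::real}"
    proof eventually_elim
      case (elim x)
      then show ?case using weight_pos[of x c t] by (auto simp: indicator_def)
    qed
    then have "{0<..<1::real} \<in> null_sets lborel"
      by (simp add: AE_iff_null_sets)
    then show False by (simp add: null_sets_def)
  qed
  moreover have "integral\<^sup>L lborel ?f \<ge> 0"
    using nn by (rule integral_nonneg_AE)
  ultimately show ?thesis by (simp add: Lf_def set_lebesgue_integral_def)
qed

lemma Lf_add:
  assumes "c > -1" "t \<ge> 0"
  shows "Lf c t (p + q) = Lf c t p + Lf c t q"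
  unfolding Lf_def using set_integrable_poly_weight[OF assms]
  by (simp add: distrib_right set_integral_add)

lemma Lf_diff:
  assumes "c > -1" "t \<ge> 0"
  shows "Lf c t (p - q) = Lf c t p - Lf c t q"
  unfolding Lf_def using set_integrable_poly_weight[OF assms]
  by (simp add: left_diff_distrib set_integral_diff)

lemma Lf_smult: "Lf c t (Polynomial.smult a p) = a * Lf c t p"
  unfolding Lf_def by (simp add: mult.assoc)

lemma Lf_0: "Lf c t 0 = 0"
  using Lf_smult[of c t 0 0] by simp

lemma Lf_sum:
  assumes "c > -1" "t \<ge> 0"
  shows "Lf c t (\<Sum>i\<in>I. p i) = (\<Sum>i\<in>I. Lf c t (p i))"
  using assms by (induction I rule: infinite_finite_induct) (simp_all add: Lf_add Lf_0)

text \<open>At \<open>c = \<alpha> - 1\<close> this says L(x p / x) = L(p), the bridge between the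
  weights w/x and w.\<close>

lemma Lf_pCons_0: "Lf c t (pCons 0 p) = Lf (c + 1) t p"
  unfolding Lf_def
  by (rule set_lebesgue_integral_cong) (auto simp: weight_shift[of _ 1 c t, simplified, symmetric])

text \<open>The operator x d/dx is diagonal on monomials, so x p' has degree at most that of
  p.\<close>

lemma coeff_pCons_0_pderiv:
  fixes p :: "'a :: {comm_semiring_1,semiring_no_zero_divisors} poly"
  shows "coeff (pCons 0 (pderiv p)) i = of_nat i * coeff p i"
  by (cases i) (simp_all add: coeff_pderiv)

text \<open>Integration by parts: \<open>\<integral> (x p(x) w(x))' dx = 0\<close>.\<close>

lemma Lf_integrate_by_parts:
  assumes "c > 0" "t > 0"
  shows "Lf c t p + Lf c t (pCons 0 (pderiv p))
           = Lf c t (pCons 0 p) - t * Lf (c - 1) t p - c * Lf c t p"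
proof -
  let ?N = "degree p"
  have deg: "degree (pCons 0 (pderiv p)) \<le> ?N"
    by (rule degree_le) (simp add: coeff_pCons_0_pderiv coeff_eq_0)
  have "t * Lf (c - 1) t p + (c + 1) * Lf c t p + Lf c t (pCons 0 (pderiv p))
          = (\<Sum>i\<le>?N. t * (coeff p i * mom (c - 1 + i) t) + (c + 1) * (coeff p i * mom (c + i) t)
                     + coeff (pCons 0 (pderiv p)) i * mom (c + i) t)"
    using assms deg by (simp add: Lf_eq_sum[where N = ?N] sum_distrib_left sum.distrib)
  \<comment> \<open>Coefficient by coefficient this is \<open>mom_rec\<close> with exponent
    \<open>c + i\<close>.\<close>
  also have "\<dots> = (\<Sum>i\<le>?N. coeff p i * mom (c + 1 + i) t)"
  proof (rule sum.cong)
    fix i :: nat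
    have "mom (c + 1 + i) t = (c + i + 1) * mom (c + i) t + t * mom (c - 1 + i) t"
      using mom_rec[of "c + i" t] assms by (simp add: algebra_simps)
    then show "t * (coeff p i * mom (c - 1 + i) t) + (c + 1) * (coeff p i * mom (c + i) t)
                 + coeff (pCons 0 (pderiv p)) i * mom (c + i) t = coeff p i * mom (c + 1 + i) t"
      by (simp add: coeff_pCons_0_pderiv algebra_simps)
  qed simp
  also have "\<dots> = Lf (c + 1) t p"
    using assms by (subst Lf_eq_sum[where N = ?N]) auto
  finally show ?thesis by (simp add: Lf_pCons_0 algebra_simps)
qed

section \<open>Identities at a fixed parameter\<close>

text \<open>Fixing one parameter value here lets the same identities be interpreted both for the
  given family at \<open>s\<close> and for the Gram-Schmidt family at every positive
  parameter.\<close>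

locale orthogonal_family =
  fixes \<alpha> t :: real and P :: "nat \<Rightarrow> real poly" and h :: "nat \<Rightarrow> real"
  assumes \<alpha>_pos: "\<alpha> > 0" and t_pos: "t > 0"
    and degree_P: "degree (P k) = k"
    and lead_coeff_P: "lead_coeff (P k) = 1"
    and orthogonal: "Lf \<alpha> t (P j * P k) = (if j = k then h j else 0)"
begin

lemma coeff_P_self: "coeff (P n) n = 1"
  using lead_coeff_P[of n] by (simp add: degree_P)

lemma coeff_P_above: "i > n \<Longrightarrow> coeff (P n) i = 0"
  by (simp add: coeff_eq_0 degree_P)

lemma P_0: "P 0 = 1"
  by (rule poly_eqI) (use coeff_P_self[of 0] coeff_P_above[of 0] in \<open>auto simp: coeff_1\<close>)

lemma P_nonzero: "P n \<noteq> 0"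
  using coeff_P_self[of n] by auto

lemma h_pos: "h n > 0"
  using Lf_pos[of \<alpha> t "P n"] \<alpha>_pos t_pos P_nonzero orthogonal[of n n] by simp

lemmas Lf_linear = Lf_add[of \<alpha> t] Lf_diff[of \<alpha> t] Lf_smult[of \<alpha> t]
  Lf_add[of "\<alpha> - 1" t] Lf_diff[of "\<alpha> - 1" t] Lf_smult[of "\<alpha> - 1" t]

text \<open>Peel off the top coefficient: subtracting a multiple of \<open>P m\<close> lowers the
  degree of \<open>r\<close>, and \<open>P m\<close> is orthogonal to \<open>P n\<close> for m <
  n.\<close>

lemma Lf_mult_P_low:
  assumes "m \<le> n" "\<And>i. i \<ge> m \<Longrightarrow> coeff r i = 0"
  shows "Lf \<alpha> t (r * P n) = 0"
  using assms
proof (induction m arbitrary: r)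
  case 0
  then have "r = 0" by (intro poly_eqI) auto
  then show ?case by (simp add: Lf_0)
next
  case (Suc m)
  let ?r = "r - Polynomial.smult (coeff r m) (P m)"
  have low: "coeff ?r i = 0" if "i \<ge> m" for i
    using that Suc.prems(2)[of i] coeff_P_self[of m] coeff_P_above[of m i] by (cases "i = m") auto
  have "Lf \<alpha> t (?r * P n) = 0" using Suc.prems(1) by (intro Suc.IH low) auto
  moreover have "Lf \<alpha> t (P m * P n) = 0" using Suc.prems by (simp add: orthogonal)
  ultimately show ?case using \<alpha>_pos t_pos by (simp add: left_diff_distrib Lf_linear)
qed

text \<open>The main evaluation rule: subtracting the right multiple of \<open>P n\<close> leaves a
  remainder of degree below n.\<close>

lemma Lf_mult_P:
  assumes "\<And>i. i > n \<Longrightarrow> coeff r i = 0"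
  shows "Lf \<alpha> t (r * P n) = coeff r n * h n"
proof -
  let ?r = "r - Polynomial.smult (coeff r n) (P n)"
  have low: "coeff ?r i = 0" if "i \<ge> n" for i
    using that assms[of i] coeff_P_self[of n] coeff_P_above[of n i] by (cases "i = n") auto
  have "Lf \<alpha> t (?r * P n) = 0" by (intro Lf_mult_P_low[of n] low) auto
  then show ?thesis using \<alpha>_pos t_pos by (simp add: left_diff_distrib Lf_linear orthogonal)
qed

text \<open>This is the coefficient of x^(n-1) in \<open>P n\<close>; the shift by
  \<open>pCons 0\<close> gives 0 at n = 0 and avoids natural subtraction.\<close>

definition subleading :: "nat \<Rightarrow> real" where
  "subleading n = coeff (pCons 0 (P n)) n"

definition A :: "nat \<Rightarrow> real" where
  "A n = t * Lf (\<alpha> - 1) t (P n * P n) / h n"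

text \<open>Shifted indices: in the usual notation \<open>B n\<close> and \<open>\<beta> n\<close> below are $b_{n+1}$ and $\beta_{n+1}$.\<close>

definition B :: "nat \<Rightarrow> real" where
  "B n = t * Lf (\<alpha> - 1) t (P (Suc n) * P n) / h n"

definition \<beta> :: "nat \<Rightarrow> real" where
  "\<beta> n = h (Suc n) / h n"

lemma A_pos: "A n > 0"
  unfolding A_def using Lf_pos[of "\<alpha> - 1" t "P n"] \<alpha>_pos t_pos P_nonzero h_pos by simp

lemma \<beta>_pos: "\<beta> n > 0"
  by (simp add: \<beta>_def h_pos)

text \<open>Integrate by parts with p = P_n^2. The left-hand side arises as L(x P_n^2)/h_n.\<close>

lemma subleading_diff: "subleading n - subleading (Suc n) = 2 * real n + 1 + \<alpha> + A n"
proof -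
  have 1: "Lf \<alpha> t (P n * P n) = h n" by (simp add: orthogonal)
  have "Lf \<alpha> t (pCons 0 (pderiv (P n)) * P n) = real n * h n"
    by (subst Lf_mult_P) (auto simp: coeff_pCons_0_pderiv coeff_P_above coeff_P_self)
  moreover have "pCons 0 (pderiv (P n * P n)) = pCons 0 (pderiv (P n)) * P n + pCons 0 (pderiv (P n)) * P n"
    by (simp add: pderiv_mult mult.commute)
  ultimately have 2: "Lf \<alpha> t (pCons 0 (pderiv (P n * P n))) = 2 * real n * h n"
    using \<alpha>_pos t_pos by (simp only: Lf_linear)
  \<comment> \<open>The leading terms cancel, so \<open>?r\<close> has degree at most n and its x^n
    coefficient is the difference of subleading coefficients.\<close>
  let ?r = "pCons 0 (P n) - P (Suc n)"
  have low: "coeff ?r i = 0" if "i > n" for i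
  proof (cases "i = Suc n")
    case False
    then obtain j where "i = Suc j" "j > n" using \<open>i > n\<close> by (cases i) auto
    then show ?thesis by (simp add: coeff_P_above)
  qed (simp add: coeff_P_self)
  have "Lf \<alpha> t (?r * P n) = (subleading n - subleading (Suc n)) * h n"
    by (subst Lf_mult_P[OF low]) (auto simp: subleading_def)
  then have 3: "Lf \<alpha> t (pCons 0 (P n * P n)) = (subleading n - subleading (Suc n)) * h n"
    using \<alpha>_pos t_pos orthogonal[of "Suc n" n] by (simp add: left_diff_distrib Lf_linear)
  have "h n + 2 * real n * h n
          = (subleading n - subleading (Suc n)) * h n - A n * h n - \<alpha> * h n"
    using Lf_integrate_by_parts[OF \<alpha>_pos t_pos, of "P n * P n"] 1 2 3 h_pos[of n]
    by (simp add: A_def)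
  then have "(subleading n - subleading (Suc n)) * h n = (2 * real n + 1 + \<alpha> + A n) * h n"
    by (simp add: algebra_simps)
  then show ?thesis using h_pos[of n] by simp
qed

lemma subleading_0: "subleading 0 = 0"
  by (simp add: subleading_def)

lemma subleading_eq: "subleading n = - (real n * (real n + \<alpha>) + (\<Sum>j<n. A j))"
proof (induction n)
  case (Suc n)
  then show ?case using subleading_diff[of n] by (simp add: algebra_simps)
qed (simp add: subleading_0)

text \<open>Integrate by parts with p = P_{n+1} P_n; only the subleading coefficient, h_{n+1} and
  the w/x term survive.\<close>

lemma \<beta>_minus_B: "\<beta> n - B n = - subleading (Suc n)"
proof -
  let ?c = "coeff (P (Suc n)) n"
  have 1: "Lf \<alpha> t (P (Suc n) * P n) = 0" by (simp add: orthogonal)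
  have 2: "Lf \<alpha> t (pCons 0 (pderiv (P n)) * P (Suc n)) = 0"
    by (subst Lf_mult_P) (auto simp: coeff_pCons_0_pderiv coeff_P_above simp del: coeff_pCons_Suc)
  \<comment> \<open>Subtracting (n+1) P_{n+1} removes the leading term of x P_{n+1}'; the x^n
    coefficient left is n c - (n+1) c = -c.\<close>
  let ?r = "pCons 0 (pderiv (P (Suc n))) - Polynomial.smult (real (Suc n)) (P (Suc n))"
  have low: "coeff ?r i = 0" if "i > n" for i
    using that coeff_P_above[of "Suc n" i]
    by (cases "i = Suc n") (auto simp: coeff_pCons_0_pderiv simp del: coeff_pCons_Suc)
  have "Lf \<alpha> t (?r * P n) = - ?c * h n"
    by (subst Lf_mult_P[OF low]) (auto simp: coeff_pCons_0_pderiv algebra_simps)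
  then have 3: "Lf \<alpha> t (pCons 0 (pderiv (P (Suc n))) * P n) = - ?c * h n"
    using \<alpha>_pos t_pos 1 by (simp only: left_diff_distrib mult_smult_left Lf_linear)
  have "coeff (pCons 0 (P n)) i = 0" if "i > Suc n" for i
    using that coeff_P_above[of n "i - 1"] by (cases i) auto
  then have "Lf \<alpha> t (pCons 0 (P n) * P (Suc n)) = h (Suc n)"
    by (subst Lf_mult_P) (auto simp: coeff_P_self)
  then have 4: "Lf \<alpha> t (pCons 0 (P (Suc n) * P n)) = h (Suc n)"
    by (simp add: mult.commute)
  have "pCons 0 (pderiv (P (Suc n) * P n))
          = pCons 0 (pderiv (P n)) * P (Suc n) + pCons 0 (pderiv (P (Suc n))) * P n"
    by (simp add: pderiv_mult mult.commute)
  then have "Lf \<alpha> t (pCons 0 (pderiv (P (Suc n) * P n))) = - ?c * h n"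
    using \<alpha>_pos t_pos 2 3 by (simp only: Lf_linear)
  then have "- ?c * h n = h (Suc n) - B n * h n"
    using Lf_integrate_by_parts[OF \<alpha>_pos t_pos, of "P (Suc n) * P n"] 1 4 h_pos[of n]
    by (simp add: B_def)
  then show ?thesis
    using h_pos[of n] by (simp add: \<beta>_def subleading_def field_simps)
qed

section \<open>Factorization through values at zero, and the quadratic relation\<close>

definition q :: "nat \<Rightarrow> real" where
  "q n = Lf (\<alpha> - 1) t (P n)"

definition P0 :: "nat \<Rightarrow> real" where
  "P0 n = poly (P n) 0"

text \<open>Write \<open>r = r(0) + x r'\<close>; dividing by \<open>x\<close> leaves \<open>r'\<close>, which is integrated against the
  original weight.\<close>

lemma Lf_minus_1_mult_P:
  assumes "\<And>i. i > Suc n \<Longrightarrow> coeff r i = 0"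
  shows "Lf (\<alpha> - 1) t (r * P n) = poly r 0 * q n + coeff r (Suc n) * h n"
proof (cases r)
  case (pCons a r')
  have "coeff r' i = 0" if "i > n" for i
    using assms[of "Suc i"] that pCons by simp
  then have "Lf \<alpha> t (r' * P n) = coeff r (Suc n) * h n"
    using pCons by (subst Lf_mult_P) auto
  then show ?thesis
    using pCons \<alpha>_pos t_pos by (simp add: Lf_linear Lf_pCons_0 q_def)
qed

text \<open>The factor \<open>q n\<close> is, up to sign, the function of the second kind of
  \<open>P n\<close> at zero.\<close>

lemma A_eq: "A n = t * P0 n * q n / h n"
  unfolding A_def by (subst Lf_minus_1_mult_P) (auto simp: coeff_P_above P0_def)

lemma B_eq: "B n = t * P0 n * q (Suc n) / h n"
proof -
  have "Lf (\<alpha> - 1) t (P n * P (Suc n)) = P0 n * q (Suc n)"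
    by (subst Lf_minus_1_mult_P) (auto simp: coeff_P_above P0_def)
  then show ?thesis by (simp add: B_def mult.commute)
qed

text \<open>Here P_{n+1} rather than P_n is split at zero, which leaves the extra term
  \<open>h n\<close>. Compared with \<open>B_eq\<close> this is the Casoratian:
  \<open>P0 n * q (Suc n) - P0 (Suc n) * q n = h n\<close>.\<close>

lemma B_minus_t: "B n - t = t * P0 (Suc n) * q n / h n"
proof -
  have "Lf (\<alpha> - 1) t (P (Suc n) * P n) = P0 (Suc n) * q n + h n"
    by (subst Lf_minus_1_mult_P) (auto simp: coeff_P_above coeff_P_self P0_def)
  then show ?thesis using h_pos[of n] by (simp add: B_def field_simps)
qed

text \<open>Both sides are t^2 times the product of \<open>P0\<close> and \<open>q\<close> at n and
  n+1, over h_n^2.\<close>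

lemma \<beta>_A_A: "\<beta> n * A (Suc n) * A n = B n * (B n - t)"
  unfolding B_minus_t using h_pos[of n] h_pos[of "Suc n"]
  by (simp add: \<beta>_def A_eq B_eq field_simps)

end

section \<open>Consequences of the three-term recurrence\<close>

locale orthogonal_recurrence = orthogonal_family +
  fixes a :: "nat \<Rightarrow> real"
  assumes rec_0: "pCons 0 (P 0) = P 1 + Polynomial.smult (a 0) (P 0)"
    and rec_Suc: "pCons 0 (P (Suc n)) = P (Suc (Suc n)) + Polynomial.smult (a (Suc n)) (P (Suc n))
                     + Polynomial.smult (\<beta> n) (P n)"
begin

text \<open>Comparing coefficients of z^n in the recurrence gives a difference of subleading
  coefficients.\<close>

lemma a_eq: "a n = 2 * real n + 1 + \<alpha> + A n"
proof -
  have "a n = subleading n - subleading (Suc n)"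
  proof (cases n)
    case 0
    then show ?thesis using arg_cong[OF rec_0, of "\<lambda>p. coeff p 0"] coeff_P_self[of 0]
      by (simp add: subleading_def)
  next
    case (Suc m)
    then show ?thesis
      using arg_cong[OF rec_Suc[of m], of "\<lambda>p. coeff p (Suc m)"] coeff_P_self[of "Suc m"]
        coeff_P_above[of m "Suc m"] by (simp add: subleading_def)
  qed
  then show ?thesis by (simp add: subleading_diff)
qed

lemma P0_rec: "P0 1 = - a 0 * P0 0" "P0 (Suc (Suc n)) = - a (Suc n) * P0 (Suc n) - \<beta> n * P0 n"
  using arg_cong[OF rec_0, of "\<lambda>p. poly p 0"] arg_cong[OF rec_Suc[of n], of "\<lambda>p. poly p 0"]
  by (simp_all add: P0_def)

text \<open>Apply L(./x) to the recurrence: L(z P_n / z) = L(P_n) vanishes except at n = 0, where it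
  contributes \<open>h 0\<close>.\<close>

lemma q_rec: "q 1 = h 0 - a 0 * q 0" "q (Suc (Suc n)) = - a (Suc n) * q (Suc n) - \<beta> n * q n"
proof -
  have "Lf \<alpha> t (P 0) = h 0" using orthogonal[of 0 0] by (simp add: P_0)
  then have "h 0 = q 1 + a 0 * q 0"
    using arg_cong[OF rec_0, of "Lf (\<alpha> - 1) t"] \<alpha>_pos t_pos
    by (simp add: Lf_linear Lf_pCons_0 q_def)
  then show "q 1 = h 0 - a 0 * q 0" by simp
  have "Lf \<alpha> t (P (Suc n)) = 0" using orthogonal[of 0 "Suc n"] by (simp add: P_0)
  then have "0 = q (Suc (Suc n)) + a (Suc n) * q (Suc n) + \<beta> n * q n"
    using arg_cong[OF rec_Suc[of n], of "Lf (\<alpha> - 1) t"] \<alpha>_pos t_pos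
    by (simp add: Lf_linear Lf_pCons_0 q_def)
  then show "q (Suc (Suc n)) = - a (Suc n) * q (Suc n) - \<beta> n * q n" by simp
qed

text \<open>Expand \<open>q (Suc (Suc n))\<close> in \<open>B (Suc n)\<close> by the recurrence; the
  remaining term is \<open>- (B n - t)\<close> by the Casoratian form.\<close>

lemma B_add: "B (Suc n) + B n = t - a (Suc n) * A (Suc n)"
proof -
  have "B (Suc n) = - a (Suc n) * A (Suc n) - (B n - t)"
    unfolding B_minus_t unfolding B_eq A_eq q_rec \<beta>_def
    using h_pos[of n] h_pos[of "Suc n"] by (simp add: field_simps)
  then show ?thesis by simp
qed

text \<open>Use the recurrence for -a_{n+1} P0(n+1) in \<open>B (Suc n)\<close> and for -a_{n+1}
  q(n+1) in \<open>B n\<close>; the cross terms P0(n) q(n+2) cancel.\<close>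

lemma B_diff: "- a (Suc n) * (B (Suc n) - B n) = \<beta> (Suc n) * A (Suc (Suc n)) - \<beta> n * A n"
  unfolding B_eq A_eq q_rec P0_rec \<beta>_def
  using h_pos[of n] h_pos[of "Suc n"] h_pos[of "Suc (Suc n)"]
  by (simp add: field_simps)

lemma \<beta>_A_add: "\<beta> n * (A (Suc n) + A n) = real (Suc n) * t - (2 * real (Suc n) + \<alpha>) * B n"
proof (induction n)
  \<comment> \<open>The base case is computed directly, since the recurrence for \<open>q\<close>
    has the extra term \<open>h 0\<close> there.\<close>
  case 0
  have q_1: "q (Suc 0) = h 0 - a 0 * q 0" using q_rec(1) by simp
  have "B 0 = t - a 0 * A 0"
    unfolding B_eq A_eq q_1 using h_pos[of 0] by (simp add: P0_def P_0 field_simps)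
  moreover have "\<beta> 0 * A 1 = - a 0 * B 0"
    unfolding B_eq A_eq \<beta>_def using P0_rec(1) h_pos[of 0] h_pos[of 1] by (simp add: field_simps)
  moreover have "\<beta> 0 = 1 + \<alpha> + A 0 + B 0"
    using \<beta>_minus_B[of 0] subleading_eq[of 1] by simp
  moreover have "a 0 = 1 + \<alpha> + A 0" by (simp add: a_eq)
  ultimately have "\<beta> 0 * A 1 + \<beta> 0 * A 0 = - a 0 * B 0 + (a 0 + B 0) * A 0"
    by simp
  also have "\<dots> = (B 0 + a 0 * A 0) - (1 + (a 0 - A 0)) * B 0"
    by (simp add: algebra_simps)
  also have "\<dots> = t - (2 + \<alpha>) * B 0"
    using \<open>B 0 = _\<close> \<open>a 0 = _\<close> by simp
  finally show ?case by (simp add: distrib_left)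
next
  case (Suc n)
  have \<beta>: "\<beta> (Suc n) = a (Suc n) + \<beta> n + (B (Suc n) - B n)"
    using \<beta>_minus_B[of n] \<beta>_minus_B[of "Suc n"] subleading_diff[of "Suc n"] a_eq[of "Suc n"] by simp
  have "\<beta> (Suc n) * (A (Suc (Suc n)) + A (Suc n))
          = \<beta> n * A n - a (Suc n) * (B (Suc n) - B n) + \<beta> (Suc n) * A (Suc n)"
    using B_diff[of n] by (simp add: distrib_left)
  also have "\<dots> = \<beta> n * (A (Suc n) + A n) + a (Suc n) * A (Suc n)
                    - (a (Suc n) - A (Suc n)) * (B (Suc n) - B n)"
    unfolding \<beta> by (simp add: algebra_simps)
  \<comment> \<open>This difference is explicit, so the increment is linear in the \<open>B\<close>
    terms; after inserting the induction hypothesis \<open>B n\<close> cancels.\<close>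
  also have "a (Suc n) - A (Suc n) = 2 * real n + 3 + \<alpha>"
    by (simp add: a_eq)
  also have "a (Suc n) * A (Suc n) = t - B (Suc n) - B n"
    using B_add[of n] by simp
  finally show ?case
    unfolding Suc.IH by (simp add: algebra_simps)
qed

end

section \<open>The Hankel determinant and uniqueness of the family\<close>

context orthogonal_family
begin

text \<open>The nested sum has the shape of an entry of a triple matrix product; the common bound
  \<open>n\<close> serves every row of the coefficient matrix.\<close>

lemma Lf_mult_eq_sum:
  assumes "\<And>i. i \<ge> n \<Longrightarrow> coeff p i = 0" "\<And>i. i \<ge> n \<Longrightarrow> coeff r i = 0"
  shows "Lf \<alpha> t (p * r) = (\<Sum>j<n. coeff p j * (\<Sum>k<n. Lf \<alpha> t (Polynomial.monom 1 (j + k)) * coeff r k))"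
proof -
  have expand: "p = (\<Sum>j<n. Polynomial.smult (coeff p j) (Polynomial.monom 1 j))"
    if "\<And>i. i \<ge> n \<Longrightarrow> coeff p i = 0" for p :: "real poly"
  proof (rule poly_eqI)
    fix i
    have "coeff p i = (\<Sum>j<n. if j = i then coeff p j else 0)"
      using that[of i] by (cases "i < n") auto
    then show "coeff p i = coeff (\<Sum>j<n. Polynomial.smult (coeff p j) (Polynomial.monom 1 j)) i"
      by (simp add: coeff_sum if_distrib cong: if_cong)
  qed
  have "p * r = (\<Sum>j<n. Polynomial.smult (coeff p j) (Polynomial.monom 1 j))
                  * (\<Sum>k<n. Polynomial.smult (coeff r k) (Polynomial.monom 1 k))"
    by (rule arg_cong2[where f = "(*)"]) (use expand assms in blast)+
  also have "\<dots> = (\<Sum>j<n. \<Sum>k<n. Polynomial.smult (coeff p j * coeff r k) (Polynomial.monom 1 (j + k)))"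
    by (simp add: sum_product mult_monom smult_monom mult.commute)
  finally have "Lf \<alpha> t (p * r)
      = Lf \<alpha> t (\<Sum>j<n. \<Sum>k<n. Polynomial.smult (coeff p j * coeff r k) (Polynomial.monom 1 (j + k)))"
    by simp
  also have "\<dots> = (\<Sum>j<n. \<Sum>k<n. coeff p j * coeff r k * Lf \<alpha> t (Polynomial.monom 1 (j + k)))"
    using \<alpha>_pos t_pos by (simp only: Lf_sum Lf_smult)
  finally show ?thesis by (simp add: sum_distrib_left mult_ac)
qed

text \<open>The congruence of the Hankel matrix by the unitriangular coefficient matrix of the \<open>P j\<close>
  makes it diagonal.\<close>

lemma hankel_det_eq: "hankel_det \<alpha> n t = (\<Prod>j<n. h j)"
proof -
  define K where "K = Matrix.mat n n (\<lambda>(j, k). moment \<alpha> t (j + k))"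
  define T where "T = Matrix.mat n n (\<lambda>(i, j). coeff (P i) j)"
  define D where "D = Matrix.mat n n (\<lambda>(i, j). if i = j then h i else 0)"
  have K: "K \<in> carrier_mat n n" and T: "T \<in> carrier_mat n n" and D: "D \<in> carrier_mat n n"
    by (auto simp: K_def T_def D_def)
  have mom: "moment \<alpha> t k = Lf \<alpha> t (Polynomial.monom 1 k)" for k
    by (simp add: moment_def Lf_def poly_monom)
  have Tt: "T\<^sup>T \<in> carrier_mat n n" using T by simp
  have "T * (K * T\<^sup>T) = D"
  proof (rule eq_matI)
    fix i l assume "i < dim_row D" "l < dim_col D"
    then have il: "i < n" "l < n" by (auto simp: D_def)
    have "(T * (K * T\<^sup>T)) $$ (i, l)
            = (\<Sum>j<n. coeff (P i) j * (\<Sum>k<n. Lf \<alpha> t (Polynomial.monom 1 (j + k)) * coeff (P l) k))"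
      using il by (simp add: T_def K_def scalar_prod_def mom lessThan_atLeast0)
    also have "\<dots> = Lf \<alpha> t (P i * P l)"
      using il by (intro Lf_mult_eq_sum[symmetric]) (auto simp: coeff_P_above)
    also have "\<dots> = D $$ (i, l)"
      using il by (simp add: orthogonal D_def)
    finally show "(T * (K * T\<^sup>T)) $$ (i, l) = D $$ (i, l)" .
  qed (use T D in auto)
  then have "Determinant.det T * (Determinant.det K * Determinant.det T) = Determinant.det D"
    using det_mult[OF T mult_carrier_mat[OF K Tt]] det_mult[OF K Tt] det_transpose[OF T] by simp
  moreover have "Determinant.det T = 1"
  proof -
    have "diag_mat T = replicate n 1"
      using T by (auto simp: diag_mat_def T_def coeff_P_self intro: nth_equalityI)
    moreover have "Determinant.det T = prod_list (diag_mat T)"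
      by (rule det_lower_triangular[OF _ T]) (auto simp: T_def coeff_P_above)
    ultimately show ?thesis by simp
  qed
  moreover have "Determinant.det D = (\<Prod>j<n. h j)"
  proof -
    have "Determinant.det D = prod_list (diag_mat D)"
      by (rule det_lower_triangular[OF _ D]) (auto simp: D_def)
    also have "diag_mat D = map h [0..<n]"
      using D by (auto simp: diag_mat_def D_def)
    finally show ?thesis
      by (simp add: prod.list_conv_set_nth lessThan_atLeast0)
  qed
  ultimately show ?thesis by (simp add: hankel_det_def K_def)
qed

text \<open>The difference of two candidates has degree below n, so it is orthogonal to both and
  hence to itself. This identifies the given family with the Gram-Schmidt one.\<close>

lemma unique:
  assumes "orthogonal_family \<alpha> t P' h'"
  shows "P' = P" "h' = h"
proof -
  interpret O: orthogonal_family \<alpha> t P' h' by fact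
  have P: "P' n = P n" for n
  proof (rule ccontr)
    assume "P' n \<noteq> P n"
    then have "P' n - P n \<noteq> 0" by simp
    from Lf_pos[OF _ _ this, of \<alpha> t] have "0 < Lf \<alpha> t ((P' n - P n) * (P' n - P n))"
      using \<alpha>_pos t_pos by simp
    also have "\<dots> = Lf \<alpha> t ((P' n - P n) * P' n) - Lf \<alpha> t ((P' n - P n) * P n)"
      using \<alpha>_pos t_pos by (simp only: right_diff_distrib Lf_linear)
    also have "Lf \<alpha> t ((P' n - P n) * P' n) = 0"
      by (subst O.Lf_mult_P) (auto simp: coeff_P_above O.coeff_P_above coeff_P_self O.coeff_P_self)
    also have "Lf \<alpha> t ((P' n - P n) * P n) = 0"
      by (subst Lf_mult_P) (auto simp: coeff_P_above O.coeff_P_above coeff_P_self O.coeff_P_self)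
    finally show False by simp
  qed
  then show "P' = P" by auto
  show "h' = h"
    using orthogonal O.orthogonal P by (metis ext)
qed

end

section \<open>Dependence on the parameter\<close>

text \<open>Gram--Schmidt, so that differentiability in \<open>t\<close> follows by recursion.\<close>

fun gs :: "real \<Rightarrow> real \<Rightarrow> nat \<Rightarrow> real poly" where
  "gs c t n = Polynomial.monom 1 n
     - (\<Sum>j<n. Polynomial.smult (Lf c t (Polynomial.monom 1 n * gs c t j) / Lf c t (gs c t j * gs c t j))
                 (gs c t j))"

declare gs.simps [simp del]

text \<open>Valid for every real parameter, so these coefficients are constant functions of it, as
  \<open>coeff_gs_deriv_high\<close> uses.\<close>

lemma coeff_gs: "coeff (gs c t n) n = 1" "i > n \<Longrightarrow> coeff (gs c t n) i = 0"
proof (induction n arbitrary: i rule: less_induct)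
  case (less n)
  {
    case 1
    then show ?case using less(2) by (subst gs.simps) (simp add: coeff_sum)
  next
    case 2
    then show ?case using less(2) by (subst gs.simps) (auto simp add: coeff_sum intro!: sum.neutral)
  }
qed

lemma gs_nonzero: "gs c t n \<noteq> 0"
  using coeff_gs(1)[of c t n] by auto

lemma degree_gs: "degree (gs c t n) = n"
proof (rule antisym)
  show "degree (gs c t n) \<le> n" by (rule degree_le) (simp add: coeff_gs)
  show "n \<le> degree (gs c t n)" by (rule le_degree) (simp add: coeff_gs)
qed

text \<open>By strong induction only the k = j term of the projection sum survives, and it cancels
  the monomial term.\<close>

lemma Lf_gs_gs_less:
  assumes "c > -1" "t \<ge> 0" "j < n"
  shows "Lf c t (gs c t n * gs c t j) = 0"
  using \<open>j < n\<close>
proof (induction n arbitrary: j rule: less_induct)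
  case (less n)
  let ?G = "gs c t"
  let ?h = "\<lambda>k. Lf c t (?G k * ?G k)"
  have orth: "Lf c t (?G k * ?G j) = 0" if "k < n" "k \<noteq> j" for k
    using less.IH[of k j] less.IH[of j k] less.prems that
    by (cases k j rule: linorder_cases) (auto simp: mult.commute)
  have "?h j > 0" using assms by (intro Lf_pos gs_nonzero)
  have "Lf c t (?G n * ?G j) = Lf c t (Polynomial.monom 1 n * ?G j)
          - (\<Sum>k<n. Lf c t (Polynomial.monom 1 n * ?G k) / ?h k * Lf c t (?G k * ?G j))"
    by (subst gs.simps)
       (use assms in \<open>simp add: left_diff_distrib Lf_diff sum_distrib_right Lf_sum Lf_smult\<close>)
  also have "(\<Sum>k<n. Lf c t (Polynomial.monom 1 n * ?G k) / ?h k * Lf c t (?G k * ?G j))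
               = (\<Sum>k<n. if k = j then Lf c t (Polynomial.monom 1 n * ?G j) else 0)"
  proof (rule sum.cong)
    fix k assume "k \<in> {..<n}"
    then show "Lf c t (Polynomial.monom 1 n * ?G k) / ?h k * Lf c t (?G k * ?G j)
                 = (if k = j then Lf c t (Polynomial.monom 1 n * ?G j) else 0)"
      using \<open>?h j > 0\<close> orth[of k] by (cases "k = j") auto
  qed simp
  finally show ?case using less.prems by simp
qed

definition gs_norm :: "real \<Rightarrow> real \<Rightarrow> nat \<Rightarrow> real" where
  "gs_norm c t n = Lf c t (gs c t n * gs c t n)"

lemma orthogonal_family_gs:
  assumes "c > 0" "t > 0"
  shows "orthogonal_family c t (gs c t) (gs_norm c t)"
proof
  show "Lf c t (gs c t j * gs c t k) = (if j = k then gs_norm c t j else 0)" for j k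
    using Lf_gs_gs_less[of c t j k] Lf_gs_gs_less[of c t k j] assms
    by (cases j k rule: linorder_cases) (auto simp: gs_norm_def mult.commute)
qed (use assms in \<open>auto simp: coeff_gs degree_gs\<close>)

text \<open>The uniform degree bound makes \<open>Lf c u (p u)\<close> a sum over a fixed index range.\<close>

definition has_poly_deriv :: "(real \<Rightarrow> real poly) \<Rightarrow> real poly \<Rightarrow> real \<Rightarrow> bool" where
  "has_poly_deriv p p' t \<longleftrightarrow>
     (\<forall>i. ((\<lambda>u. coeff (p u) i) has_real_derivative coeff p' i) (at t)) \<and>
     (\<exists>N. \<forall>u. degree (p u) \<le> N)"

lemma has_poly_deriv_const: "has_poly_deriv (\<lambda>_. p) 0 t"
  by (auto simp: has_poly_deriv_def)

lemma has_poly_deriv_add: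
  assumes "has_poly_deriv p p' t" "has_poly_deriv r r' t"
  shows "has_poly_deriv (\<lambda>u. p u + r u) (p' + r') t"
proof -
  from assms obtain M N where "\<forall>u. degree (p u) \<le> M" "\<forall>u. degree (r u) \<le> N"
    by (auto simp: has_poly_deriv_def)
  then have "\<forall>u. degree (p u + r u) \<le> max M N"
    by (meson degree_add_le le_max_iff_disj)
  then show ?thesis
    using assms by (auto simp: has_poly_deriv_def intro!: derivative_eq_intros)
qed

lemma has_poly_deriv_mult:
  assumes "has_poly_deriv p p' t" "has_poly_deriv r r' t"
  shows "has_poly_deriv (\<lambda>u. p u * r u) (p' * r t + p t * r') t"
proof -
  from assms obtain M N where "\<forall>u. degree (p u) \<le> M" "\<forall>u. degree (r u) \<le> N"
    by (auto simp: has_poly_deriv_def)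
  then have "\<forall>u. degree (p u * r u) \<le> M + N"
    by (meson degree_mult_le add_mono order_trans)
  moreover have "((\<lambda>u. coeff (p u * r u) i) has_real_derivative coeff (p' * r t + p t * r') i) (at t)" for i
  proof -
    have "((\<lambda>u. \<Sum>j\<le>i. coeff (p u) j * coeff (r u) (i - j)) has_real_derivative
            (\<Sum>j\<le>i. coeff (p t) j * coeff r' (i - j) + coeff p' j * coeff (r t) (i - j))) (at t)"
      using assms by (intro DERIV_sum DERIV_mult') (auto simp: has_poly_deriv_def)
    then show ?thesis by (simp add: coeff_mult sum.distrib add.commute)
  qed
  ultimately show ?thesis by (auto simp: has_poly_deriv_def)
qed

lemma has_poly_deriv_real:
  assumes "(f has_real_derivative f') (at t)"
  shows "has_poly_deriv (\<lambda>u. [:f u:]) [:f':] t"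
  using assms by (auto simp: has_poly_deriv_def coeff_pCons split: nat.splits)

lemma has_poly_deriv_smult:
  assumes "(f has_real_derivative f') (at t)" "has_poly_deriv p p' t"
  shows "has_poly_deriv (\<lambda>u. Polynomial.smult (f u) (p u))
           (Polynomial.smult f' (p t) + Polynomial.smult (f t) p') t"
  using has_poly_deriv_mult[OF has_poly_deriv_real[OF assms(1)] assms(2)] by simp

lemma has_poly_deriv_sum:
  assumes "\<And>j. j \<in> I \<Longrightarrow> has_poly_deriv (p j) (p' j) t"
  shows "has_poly_deriv (\<lambda>u. \<Sum>j\<in>I. p j u) (\<Sum>j\<in>I. p' j) t"
  using assms
  by (induction I rule: infinite_finite_induct)
     (simp_all add: has_poly_deriv_const has_poly_deriv_add)

text \<open>Product rule: the polynomial contributes \<open>p'\<close>, and the weight contributes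
  -w/x, that is, the functional at \<open>c - 1\<close>.\<close>

lemma has_real_derivative_Lf:
  assumes "has_poly_deriv p p' t" "c > 0" "t > 0"
  shows "((\<lambda>u. Lf c u (p u)) has_real_derivative Lf c t p' - Lf (c - 1) t (p t)) (at t)"
proof -
  from assms obtain N where "\<And>u. degree (p u) \<le> N" by (auto simp: has_poly_deriv_def)
  define M where "M = max N (degree p')"
  have deg: "degree (p u) \<le> M" "degree p' \<le> M" for u
    using \<open>degree (p u) \<le> N\<close> by (auto simp: M_def)
  have "((\<lambda>u. \<Sum>i\<le>M. coeff (p u) i * mom (c + i) u) has_real_derivative
          (\<Sum>i\<le>M. coeff p' i * mom (c + i) t + - mom (c + i - 1) t * coeff (p t) i)) (at t)"
    using assms by (intro DERIV_sum DERIV_mult has_real_derivative_mom) (auto simp: has_poly_deriv_def)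
  also have "(\<Sum>i\<le>M. coeff p' i * mom (c + i) t + - mom (c + i - 1) t * coeff (p t) i)
               = Lf c t p' - Lf (c - 1) t (p t)"
    using assms deg by (simp add: Lf_eq_sum[where N = M] algebra_simps flip: sum_subtractf)
  finally show ?thesis
    \<comment> \<open>The coefficient formula for \<open>Lf\<close> is available for nonnegative
      parameters, so the two functions are identified on an open half line.\<close>
    by (rule has_field_derivative_transform_within_open[where S = "{0<..}"])
       (use assms deg in \<open>auto simp: Lf_eq_sum[where N = M]\<close>)
qed

text \<open>Strong induction along Gram-Schmidt, whose denominators are positive norms. Existence
  suffices: orthogonality later determines the relevant data of \<open>p'\<close>.\<close>

lemma has_poly_deriv_gs:
  assumes "c > 0" "t > 0"
  shows "\<exists>p'. has_poly_deriv (\<lambda>u. gs c u n) p' t"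
proof (induction n rule: less_induct)
  case (less n)
  then obtain g' where g': "\<And>j. j < n \<Longrightarrow> has_poly_deriv (\<lambda>u. gs c u j) (g' j) t"
    by metis
  define f where "f = (\<lambda>j u. Polynomial.smult
      (- (Lf c u (Polynomial.monom 1 n * gs c u j) / Lf c u (gs c u j * gs c u j))) (gs c u j))"
  have "\<exists>p'. has_poly_deriv (f j) p' t" if "j < n" for j
  proof -
    note L1 = has_real_derivative_Lf[OF has_poly_deriv_mult
        [OF has_poly_deriv_const[of "Polynomial.monom 1 n"] g'[OF that]] assms]
    note L2 = has_real_derivative_Lf[OF has_poly_deriv_mult[OF g'[OF that] g'[OF that]] assms]
    have "Lf c t (gs c t j * gs c t j) \<noteq> 0"
      using Lf_pos[of c t "gs c t j"] assms gs_nonzero by simp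
    from has_poly_deriv_smult[OF DERIV_minus[OF DERIV_divide[OF L1 L2 this]] g'[OF that]]
    show ?thesis unfolding f_def by blast
  qed
  then obtain d where d: "\<And>j. j < n \<Longrightarrow> has_poly_deriv (f j) (d j) t"
    by metis
  have gs_eq: "(\<lambda>u. gs c u n) = (\<lambda>u. Polynomial.monom 1 n + (\<Sum>j<n. f j u))"
    by (rule ext, subst gs.simps) (simp add: f_def sum_negf)
  have "has_poly_deriv (\<lambda>u. Polynomial.monom 1 n + (\<Sum>j<n. f j u)) (0 + (\<Sum>j<n. d j)) t"
    using d by (intro has_poly_deriv_add has_poly_deriv_const has_poly_deriv_sum) auto
  then show ?case unfolding gs_eq by blast
qed

text \<open>Monicity fixes the leading coefficient, so the parameter derivative has degree below n
  and is orthogonal to the polynomial itself.\<close>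

lemma coeff_gs_deriv_high:
  assumes "has_poly_deriv (\<lambda>u. gs c u n) p' t" "i \<ge> n"
  shows "coeff p' i = 0"
proof -
  have "((\<lambda>u. coeff (gs c u n) i) has_real_derivative coeff p' i) (at t)"
    using assms by (simp add: has_poly_deriv_def)
  moreover have "(\<lambda>u. coeff (gs c u n) i) = (\<lambda>_. if i = n then 1 else 0)"
    using assms(2) by (auto simp: coeff_gs)
  ultimately have "((\<lambda>_. if i = n then 1 else 0) has_real_derivative coeff p' i) (at t)"
    by simp
  then show ?thesis
    by (rule DERIV_unique) (rule DERIV_const)
qed

text \<open>This is h_n' = -h_n A_n / t: both terms that differentiate the polynomial vanish by
  orthogonality.\<close>

lemma has_real_derivative_gs_norm:
  assumes "c > 0" "t > 0"
  shows "((\<lambda>u. gs_norm c u n) has_real_derivative - Lf (c - 1) t (gs c t n * gs c t n)) (at t)"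
proof -
  interpret orthogonal_family c t "gs c t" "gs_norm c t" by (rule orthogonal_family_gs) fact+
  obtain p' where p': "has_poly_deriv (\<lambda>u. gs c u n) p' t"
    using has_poly_deriv_gs[OF assms] by blast
  have 0: "Lf c t (p' * gs c t n) = 0"
    using coeff_gs_deriv_high[OF p'] by (subst Lf_mult_P) auto
  moreover have "Lf c t (gs c t n * p') = 0"
    using 0 by (simp only: mult.commute)
  ultimately have "Lf c t (p' * gs c t n + gs c t n * p') = 0"
    using assms by (subst Lf_add) auto
  then show ?thesis
    using has_real_derivative_Lf[OF has_poly_deriv_mult[OF p' p'] assms] by (simp add: gs_norm_def)
qed

text \<open>Differentiate the relation L(P_{n+1} P_n) = 0, valid for all positive parameters, and
  solve for the top coefficient of the derivative of P_{n+1}.\<close>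

lemma has_real_derivative_gs_subleading:
  assumes "c > 0" "t > 0"
  shows "((\<lambda>u. coeff (gs c u (Suc n)) n) has_real_derivative
           Lf (c - 1) t (gs c t (Suc n) * gs c t n) / gs_norm c t n) (at t)"
proof -
  interpret orthogonal_family c t "gs c t" "gs_norm c t" by (rule orthogonal_family_gs) fact+
  obtain p' where p': "has_poly_deriv (\<lambda>u. gs c u (Suc n)) p' t"
    using has_poly_deriv_gs[OF assms] by blast
  obtain r' where r': "has_poly_deriv (\<lambda>u. gs c u n) r' t"
    using has_poly_deriv_gs[OF assms] by blast
  have 1: "Lf c t (p' * gs c t n) = coeff p' n * gs_norm c t n"
    using coeff_gs_deriv_high[OF p'] by (subst Lf_mult_P) auto
  have 2: "Lf c t (gs c t (Suc n) * r') = 0"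
    using coeff_gs_deriv_high[OF r'] by (subst mult.commute, subst Lf_mult_P) auto
  have "((\<lambda>_. 0) has_real_derivative
      Lf c t (p' * gs c t n + gs c t (Suc n) * r') - Lf (c - 1) t (gs c t (Suc n) * gs c t n)) (at t)"
    by (rule has_field_derivative_transform_within_open[where S = "{0<..}",
          OF has_real_derivative_Lf[OF has_poly_deriv_mult[OF p' r'] assms]])
       (use assms Lf_gs_gs_less[of c _ n "Suc n"] in auto)
  then have "Lf c t (p' * gs c t n + gs c t (Suc n) * r') - Lf (c - 1) t (gs c t (Suc n) * gs c t n) = 0"
    by (rule DERIV_unique) (rule DERIV_const)
  then have "coeff p' n * gs_norm c t n = Lf (c - 1) t (gs c t (Suc n) * gs c t n)"
    using 1 2 assms by (simp add: Lf_add)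
  then have "coeff p' n = Lf (c - 1) t (gs c t (Suc n) * gs c t n) / gs_norm c t n"
    using h_pos[of n] by (simp add: field_simps)
  then show ?thesis using p' by (metis has_poly_deriv_def)
qed

section \<open>The logarithmic derivative of the Hankel determinant\<close>

lemma log_deriv_hankel_eq_subleading:
  assumes "\<alpha> > 0" "t > 0"
  shows "log_deriv_hankel \<alpha> (Suc m) t
           = real (Suc m) * (real (Suc m) + \<alpha>) + coeff (gs \<alpha> t (Suc m)) m"
proof -
  interpret orthogonal_family \<alpha> t "gs \<alpha> t" "gs_norm \<alpha> t" by (rule orthogonal_family_gs) fact+
  have pos: "gs_norm \<alpha> u j > 0" if "u > 0" for u j
    using orthogonal_family.h_pos[OF orthogonal_family_gs[OF assms(1) that]] .
  have "((\<lambda>u. ln (gs_norm \<alpha> u j)) has_real_derivative - A j / t) (at t)" for j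
    using has_real_derivative_gs_norm[OF assms, of j] pos[OF assms(2), of j] assms
    by (auto intro!: derivative_eq_intros simp: A_def)
  then have "((\<lambda>u. \<Sum>j<Suc m. ln (gs_norm \<alpha> u j)) has_real_derivative (\<Sum>j<Suc m. - A j / t)) (at t)"
    by (intro DERIV_sum) auto
  then have "((\<lambda>u. ln (hankel_det \<alpha> (Suc m) u)) has_real_derivative (\<Sum>j<Suc m. - A j / t)) (at t)"
  proof (rule has_field_derivative_transform_within_open[where S = "{0<..}"])
    fix u :: real assume "u \<in> {0<..}"
    then have u: "u > 0" by simp
    show "(\<Sum>j<Suc m. ln (gs_norm \<alpha> u j)) = ln (hankel_det \<alpha> (Suc m) u)"
      unfolding orthogonal_family.hankel_det_eq[OF orthogonal_family_gs[OF assms(1) u]]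
      by (rule ln_prod[symmetric]) (auto simp: pos[OF u, THEN less_imp_neq, THEN not_sym])
  qed (use assms in auto)
  then have "deriv (\<lambda>u. ln (hankel_det \<alpha> (Suc m) u)) t = (\<Sum>j<Suc m. - A j / t)"
    by (rule DERIV_imp_deriv)
  also have "\<dots> = - (\<Sum>j<Suc m. A j) / t"
    by (simp add: sum_negf sum_divide_distrib del: sum.lessThan_Suc)
  finally have "log_deriv_hankel \<alpha> (Suc m) t = - (\<Sum>j<Suc m. A j)"
    using assms by (simp add: log_deriv_hankel_def)
  then show ?thesis
    using subleading_eq[of "Suc m"] by (simp add: subleading_def)
qed

text \<open>The derivative is \<open>B m / t\<close>; \<open>\<beta>_minus_B\<close> rewrites it
  through quantities whose own derivatives are known, ready for a second differentiation.\<close>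

lemma deriv_log_deriv_hankel:
  assumes "\<alpha> > 0" "t > 0"
  shows "(log_deriv_hankel \<alpha> (Suc m) has_real_derivative
           (gs_norm \<alpha> t (Suc m) / gs_norm \<alpha> t m + log_deriv_hankel \<alpha> (Suc m) t
              - real (Suc m) * (real (Suc m) + \<alpha>)) / t) (at t)"
proof -
  interpret orthogonal_family \<alpha> t "gs \<alpha> t" "gs_norm \<alpha> t" by (rule orthogonal_family_gs) fact+
  have "((\<lambda>u. real (Suc m) * (real (Suc m) + \<alpha>) + coeff (gs \<alpha> u (Suc m)) m)
          has_real_derivative 0 + B m / t) (at t)"
    using has_real_derivative_gs_subleading[OF assms, of m] assms
    by (intro DERIV_add DERIV_const) (simp add: B_def)
  then have "(log_deriv_hankel \<alpha> (Suc m) has_real_derivative 0 + B m / t) (at t)"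
    by (rule has_field_derivative_transform_within_open[where S = "{0<..}"])
       (use assms in \<open>auto simp: log_deriv_hankel_eq_subleading\<close>)
  moreover have "B m = gs_norm \<alpha> t (Suc m) / gs_norm \<alpha> t m + log_deriv_hankel \<alpha> (Suc m) t
              - real (Suc m) * (real (Suc m) + \<alpha>)"
    using \<beta>_minus_B[of m] log_deriv_hankel_eq_subleading[OF assms, of m]
    by (simp add: \<beta>_def subleading_def)
  ultimately show ?thesis by simp
qed

text \<open>Differentiating t H' = \<beta> + H - const gives t H'' = \<beta>', and \<beta>' follows
  from the derivatives of the two norms.\<close>

lemma deriv2_log_deriv_hankel:
  assumes "\<alpha> > 0" "t > 0"
  shows "t * t * deriv (deriv (log_deriv_hankel \<alpha> (Suc m))) t
           = gs_norm \<alpha> t (Suc m) / gs_norm \<alpha> t m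
               * (t * Lf (\<alpha> - 1) t (gs \<alpha> t m * gs \<alpha> t m) / gs_norm \<alpha> t m
                  - t * Lf (\<alpha> - 1) t (gs \<alpha> t (Suc m) * gs \<alpha> t (Suc m)) / gs_norm \<alpha> t (Suc m))"
proof -
  interpret orthogonal_family \<alpha> t "gs \<alpha> t" "gs_norm \<alpha> t" by (rule orthogonal_family_gs) fact+
  let ?H = "log_deriv_hankel \<alpha> (Suc m)" and ?\<beta> = "\<lambda>u. gs_norm \<alpha> u (Suc m) / gs_norm \<alpha> u m"
  let ?C = "real (Suc m) * (real (Suc m) + \<alpha>)"
  let ?H' = "(?\<beta> t + ?H t - ?C) / t"
  let ?\<beta>' = "?\<beta> t * (Lf (\<alpha> - 1) t (gs \<alpha> t m * gs \<alpha> t m) / gs_norm \<alpha> t m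
                  - Lf (\<alpha> - 1) t (gs \<alpha> t (Suc m) * gs \<alpha> t (Suc m)) / gs_norm \<alpha> t (Suc m))"
  have "(?\<beta> has_real_derivative ?\<beta>') (at t)"
    by (rule DERIV_cong[OF DERIV_divide[OF has_real_derivative_gs_norm[OF assms, of "Suc m"]
          has_real_derivative_gs_norm[OF assms, of m]]])
       (use h_pos[of m] h_pos[of "Suc m"] in \<open>auto simp: field_simps\<close>)
  then have "((\<lambda>u. (?\<beta> u + ?H u - ?C) / u) has_real_derivative
          ((?\<beta>' + ?H' - 0) * t - (?\<beta> t + ?H t - ?C) * 1) / (t * t)) (at t)"
    using deriv_log_deriv_hankel[OF assms, of m] assms
    by (intro DERIV_divide DERIV_diff DERIV_add DERIV_const DERIV_ident) auto
  then have "(deriv ?H has_real_derivative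
          ((?\<beta>' + ?H' - 0) * t - (?\<beta> t + ?H t - ?C) * 1) / (t * t)) (at t)"
  proof (rule has_field_derivative_transform_within_open[where S = "{0<..}"])
    show "(?\<beta> u + ?H u - ?C) / u = deriv ?H u" if "u \<in> {0<..}" for u
      using DERIV_imp_deriv[OF deriv_log_deriv_hankel[OF assms(1), of u m]] that by simp
  qed (use assms in auto)
  then have "deriv (deriv ?H) t = ((?\<beta>' + ?H' - 0) * t - (?\<beta> t + ?H t - ?C) * 1) / (t * t)"
    by (rule DERIV_imp_deriv)
  \<comment> \<open>The H' terms of the quotient rule cancel; x stands for \<open>?\<beta>'\<close>
    and y for the numerator.\<close>
  moreover have "t * t * (((x + y / t - 0) * t - y * 1) / (t * t)) = t * x" for x y
    using assms by (simp add: field_simps)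
  ultimately have "t * t * deriv (deriv ?H) t = t * ?\<beta>'"
    by (simp only:)
  then show ?thesis
    by (simp only: right_diff_distrib times_divide_eq_right mult.left_commute[of t])
qed

theorem mainTheorem8:
  fixes \<alpha> s :: real and n :: nat
    and P :: "nat \<Rightarrow> real poly" and h a b :: "nat \<Rightarrow> real"
    and H :: "real \<Rightarrow> real"
  assumes "\<alpha> > 0" and "s > 0" and "n \<ge> 1"
    and "monic_orthogonal \<alpha> s P h"
    and "recurrence_coefficients P h a b"
  defines "H \<equiv> log_deriv_hankel \<alpha> n"
  shows "a n = 2 * real n + 1 + \<alpha>
           + (2 * s * (deriv H s)\<^sup>2 - 2 * s * deriv H s)
             / (s * deriv (deriv H) s + real n - (2 * real n + \<alpha>) * deriv H s)
       \<and> b n = real n * (real n + \<alpha>) + s * deriv H s - H s"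
proof -
  obtain m where n: "n = Suc m" using \<open>n \<ge> 1\<close> by (cases n) auto
  interpret orthogonal_family \<alpha> s P h
  proof
    show "lead_coeff (P k) = 1" for k
      using assms(4) unfolding monic_orthogonal_def by blast
  qed (use assms(1,2,4) in \<open>simp_all add: monic_orthogonal_def Lf_def\<close>)
  have rec: "pCons 0 (P 0) = P 1 + Polynomial.smult (a 0) (P 0)"
    "\<And>k. pCons 0 (P (Suc k)) = P (Suc (Suc k)) + Polynomial.smult (a (Suc k)) (P (Suc k))
            + Polynomial.smult (b (Suc k)) (P k)"
    and b: "\<And>k. b (Suc k) = \<beta> k"
    using assms(5) by (auto simp: recurrence_coefficients_def \<beta>_def)
  interpret orthogonal_recurrence \<alpha> s P h a
    by unfold_locales (use rec b in auto)
  \<comment> \<open>Uniqueness at the single point \<open>s\<close> transfers the derivative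
    formulas to the given family.\<close>
  have eq: "gs \<alpha> s = P" "gs_norm \<alpha> s = h"
    using unique[OF orthogonal_family_gs[OF assms(1,2)]] by auto
  have "deriv H s = (\<beta> m + H s - real n * (real n + \<alpha>)) / s"
    using DERIV_imp_deriv[OF deriv_log_deriv_hankel[OF assms(1,2), of m]]
    by (simp add: H_def n eq \<beta>_def)
  also have "\<beta> m + H s - real n * (real n + \<alpha>) = B m"
    using \<beta>_minus_B[of m] log_deriv_hankel_eq_subleading[OF assms(1,2), of m]
    by (simp add: H_def n eq subleading_def)
  finally have H': "s * deriv H s = B m"
    using assms(2) by simp
  have "s * s * deriv (deriv H) s = \<beta> m * (A m - A (Suc m))"
    using deriv2_log_deriv_hankel[OF assms(1,2), of m]
    by (simp only: H_def n eq \<beta>_def A_def)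
  \<comment> \<open>Adding \<open>\<beta>_A_add\<close> to the formula for s^2 H'' cancels
    \<open>A (Suc m)\<close>.\<close>
  then have denom: "s * (s * deriv (deriv H) s + real n - (2 * real n + \<alpha>) * deriv H s) = 2 * \<beta> m * A m"
    using \<beta>_A_add[of m] unfolding H'[symmetric] by (simp add: n algebra_simps)
  \<comment> \<open>The left side is 2 B (B - s) with B = s H', so \<open>\<beta>_A_A\<close>
    applies.\<close>
  have num: "s * (2 * s * (deriv H s)\<^sup>2 - 2 * s * deriv H s) = 2 * \<beta> m * A m * A (Suc m)"
    using \<beta>_A_A[of m] by (simp add: power2_eq_square algebra_simps flip: H')
  let ?N = "2 * s * (deriv H s)\<^sup>2 - 2 * s * deriv H s"
    and ?D = "s * deriv (deriv H) s + real n - (2 * real n + \<alpha>) * deriv H s"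
  have "?N / ?D = (s * ?N) / (s * ?D)"
    by (rule mult_divide_mult_cancel_left[symmetric]) (use assms(2) in simp)
  also have "\<dots> = (2 * \<beta> m * A m * A (Suc m)) / (2 * \<beta> m * A m)"
    by (simp only: num denom)
  \<comment> \<open>Positivity of \<open>\<beta> m\<close> and \<open>A m\<close> makes the
    denominator nonzero, so the cancellation is genuine.\<close>
  also have "\<dots> = A (Suc m)"
    using \<beta>_pos[of m] A_pos[of m] by simp
  finally have "a n = 2 * real n + 1 + \<alpha>
           + (2 * s * (deriv H s)\<^sup>2 - 2 * s * deriv H s)
             / (s * deriv (deriv H) s + real n - (2 * real n + \<alpha>) * deriv H s)"
    using a_eq[of n] by (simp add: n)
  moreover have "b n = real n * (real n + \<alpha>) + s * deriv H s - H s"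
    unfolding H' using \<open>\<beta> m + H s - _ = B m\<close> by (simp add: n b)
  ultimately show ?thesis by simp
qed

end
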